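(* If $y\in\mathcal{R}(T)$ and $\gamma>0$, then $$0\le m^\gamma(\delta,y^\delta)\le m^\infty(\delta,y^\delta)<\infty .$$
   Context: $T:\mathcal{X}\to\mathcal{Y}$ is a continuous linear operator between Hilbert spaces whose range $\mathcal{R}(T)$ is not closed. Exact data $y\in\mathcal{R}(T)$ and noisy data $y^\delta\in\mathcal{Y}$ satisfy $\|y^\delta-y\|\le\delta$ with known noise level $\delta>0$. SINE with parameter $\gamma>0$: $x_0^{\mathrm{SINE}}=0$ and, for $m\ge1$, $x_m^{\mathrm{SINE}}=\mathrm{argmin}_{x\in\mathcal{Q}_m}\|y^\delta-Tx\|$ with $$\mathcal{Q}_m=\mathrm{span}\{T^*y^\delta,(I+T^*T/\gamma)^{-1}T^*y^\delta,\ldots,(I+T^*T/\gamma)^{-m+1}T^*y^\delta\}.$$ CGNE: $x_0^{\mathrm{CGNE}}=0$ and, for $m\ge1$, $x_m^{\mathrm{CGNE}}=\mathrm{argmin}_{x\in\mathcal{K}_m}\|y^\delta-Tx\|$ with $$\mathcal{K}_m=\mathrm{span}\{T^*y^\delta,(T^*T)T^*y^\delta,\ldots,(T^*T)^{m-1}T^*y^\delta\}.$$ (Both minimisers are unique.) Fix $\tau>1$, the same for both methods. The stopping index given by the discrepancy principle is $\min\{m\in\mathbb{N}_0:\|y^\delta-Tx_m\|\le\tau\delta\}$; it is denoted $m^\gamma(\delta,y^\delta)$ when $x_m=x_m^{\mathrm{SINE}}$ (with parameter $\gamma$) and $m^\infty(\delta,y^\delta)$ when $x_m=x_m^{\mathrm{CGNE}}$.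 *)

theory Defs
  imports "HOL-Analysis.Analysis" "HOL-Library.Extended_Nat"
begin

text \<open>
  Hilbert spaces over the reals and over the complex numbers are treated uniformly.
  The scalar fields are the normed fields \<open>\<real> + \<real> i\<close>, with \<open>i = 0\<close> (the reals)
  or \<open>i * i = - 1\<close> (the complex numbers).
\<close>

class real_or_complex = real_normed_field +
  assumes real_or_complex:
    "\<exists>i. (i = 0 \<or> i * i = - 1) \<and> (\<forall>c. \<exists>a b :: real. c = a *\<^sub>R 1 + b *\<^sub>R i)"

instance real :: real_or_complex
  by standard (rule exI [of _ 0], simp)

instance complex :: real_or_complex
proof
  show "\<exists>i::complex. (i = 0 \<or> i * i = - 1)
      \<and> (\<forall>c. \<exists>a b :: real. c = a *\<^sub>R 1 + b *\<^sub>R i)"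
    by (rule exI [of _ \<i>]) (auto simp: complex_eq_iff intro: exI [of _ "Re c" for c])
qed

text \<open>
  A Hilbert space over \<open>'k\<close> is a real Hilbert space whose inner product \<open>\<bullet>\<close> is the real
  part of the scalar product, together with a compatible multiplication by scalars in \<open>'k\<close>.
  The lemmas below recover the complex scalar product and show that it gives the same
  adjoints as its real part, so that the library's \<open>adjoint\<close> is the right notion over
  both fields.
\<close>

definition hilbert_space_over ::
  "('k::real_or_complex \<Rightarrow> 'a::{real_inner, complete_space} \<Rightarrow> 'a) \<Rightarrow> bool" where
  "hilbert_space_over s \<longleftrightarrow> vector_space s
     \<and> (\<forall>r x. s (of_real r) x = r *\<^sub>R x)
     \<and> (\<forall>c x. norm (s c x) = norm c * norm x)"

lemma hilbert_space_over_real: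
  "hilbert_space_over (scaleR :: real \<Rightarrow> 'a::{real_inner, complete_space} \<Rightarrow> 'a)"
  unfolding hilbert_space_over_def by (simp add: real_vector.vector_space_axioms)

definition complex_inner ::
  "(complex \<Rightarrow> 'a::{real_inner, complete_space} \<Rightarrow> 'a) \<Rightarrow> 'a \<Rightarrow> 'a \<Rightarrow> complex" where
  "complex_inner s x y = Complex (x \<bullet> y) (x \<bullet> s \<i> y)"

lemma inner_scale_ii:
  fixes s :: "complex \<Rightarrow> 'a::{real_inner, complete_space} \<Rightarrow> 'a"
  assumes "hilbert_space_over s"
  shows "s \<i> x \<bullet> y = - (x \<bullet> s \<i> y)"
proof -
  interpret vector_space s using assms by (simp add: hilbert_space_over_def)
  have n: "norm (s \<i> z) = norm z" for z
    using assms by (simp add: hilbert_space_over_def)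
  have iso: "s \<i> u \<bullet> s \<i> v = u \<bullet> v" for u v
    using n [of "u + v"] n [of u] n [of v]
    by (simp add: dot_norm scale_right_distrib [symmetric])
  have "s \<i> (s \<i> x) = - x"
    by simp
  then show ?thesis
    using iso [of "s \<i> x" y] by simp
qed

lemma complex_inner:
  fixes s :: "complex \<Rightarrow> 'a::{real_inner, complete_space} \<Rightarrow> 'a"
  assumes "hilbert_space_over s"
  shows "complex_inner s (x + x') y = complex_inner s x y + complex_inner s x' y"
    and "complex_inner s (s c x) y = c * complex_inner s x y"
    and "complex_inner s y x = cnj (complex_inner s x y)"
    and "complex_inner s x x = of_real ((norm x)\<^sup>2)"
proof -
  interpret vector_space s using assms by (simp add: hilbert_space_over_def)
  note skew = inner_scale_ii [OF assms]
  have re: "s (of_real r) z = r *\<^sub>R z" for r z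
    using assms by (simp add: hilbert_space_over_def)
  have sc: "s c z = Re c *\<^sub>R z + Im c *\<^sub>R s \<i> z" for c z
  proof -
    have "s c z = s (of_real (Re c) + of_real (Im c) * \<i>) z"
      by (metis complex_eq mult.commute)
    also have "\<dots> = s (of_real (Re c)) z + s (of_real (Im c)) (s \<i> z)"
      by (simp only: scale_left_distrib scale_scale)
    finally show ?thesis by (simp only: re)
  qed
  have ii: "s \<i> u \<bullet> s \<i> v = u \<bullet> v" for u v
    using skew [of u "s \<i> v"] by simp
  have z: "x \<bullet> s \<i> x = 0"
    using skew [of x x] by (simp add: inner_commute)
  show "complex_inner s (x + x') y = complex_inner s x y + complex_inner s x' y"
    by (simp add: complex_inner_def complex_eq_iff inner_add_left)
  show "complex_inner s (s c x) y = c * complex_inner s x y"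
    by (subst sc) (simp add: complex_inner_def complex_eq_iff inner_add_left ii skew)
  show "complex_inner s y x = cnj (complex_inner s x y)"
    using skew [of x y] by (simp add: complex_inner_def complex_eq_iff inner_commute)
  show "complex_inner s x x = of_real ((norm x)\<^sup>2)"
    by (simp add: complex_inner_def complex_eq_iff z power2_norm_eq_inner)
qed

lemma complex_adjoint_iff:
  fixes sX :: "complex \<Rightarrow> 'a::{real_inner, complete_space} \<Rightarrow> 'a"
    and sY :: "complex \<Rightarrow> 'b::{real_inner, complete_space} \<Rightarrow> 'b"
  assumes "hilbert_space_over sX" "hilbert_space_over sY" "Vector_Spaces.linear sX sY T"
  shows "(\<forall>x y. complex_inner sY (T x) y = complex_inner sX x (f y))
     \<longleftrightarrow> (\<forall>x y. T x \<bullet> y = x \<bullet> f y)"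
proof -
  have "T (sX \<i> x) = sY \<i> (T x)" for x
    using assms(3) by (simp add: Vector_Spaces.linear_iff)
  then show ?thesis
    using inner_scale_ii [OF assms(1)] inner_scale_ii [OF assms(2)]
    by (simp add: complex_inner_def complex_eq_iff) (metis neg_equal_iff_equal)
qed

definition krylov_space ::
  "('k::real_or_complex \<Rightarrow> 'a \<Rightarrow> 'a) \<Rightarrow> ('a::{real_inner, complete_space} \<Rightarrow> 'a) \<Rightarrow> 'a \<Rightarrow> nat \<Rightarrow> 'a set"
  where
  "krylov_space s A v m = module.span s ((\<lambda>j. (A ^^ j) v) ` {..<m})"

definition CGNE_space ::
  "('k::real_or_complex \<Rightarrow> 'a \<Rightarrow> 'a) \<Rightarrow> ('a::{real_inner, complete_space} \<Rightarrow> 'b::{real_inner, complete_space})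
    \<Rightarrow> 'b \<Rightarrow> nat \<Rightarrow> 'a set" where
  "CGNE_space s T b m = krylov_space s (\<lambda>x. adjoint T (T x)) (adjoint T b) m"

definition SINE_space ::
  "('k::real_or_complex \<Rightarrow> 'a \<Rightarrow> 'a) \<Rightarrow> ('a::{real_inner, complete_space} \<Rightarrow> 'b::{real_inner, complete_space})
    \<Rightarrow> real \<Rightarrow> 'b \<Rightarrow> nat \<Rightarrow> 'a set" where
  "SINE_space s T \<gamma> b m =
     krylov_space s (inv (\<lambda>x. x + (1 / \<gamma>) *\<^sub>R adjoint T (T x))) (adjoint T b) m"

definition CGNE ::
  "('k::real_or_complex \<Rightarrow> 'a \<Rightarrow> 'a) \<Rightarrow> ('a::{real_inner, complete_space} \<Rightarrow> 'b::{real_inner, complete_space})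
    \<Rightarrow> 'b \<Rightarrow> nat \<Rightarrow> 'a" where
  "CGNE s T b m =
     (if m = 0 then 0 else arg_min_on (\<lambda>x. norm (b - T x)) (CGNE_space s T b m))"

definition SINE ::
  "('k::real_or_complex \<Rightarrow> 'a \<Rightarrow> 'a) \<Rightarrow> ('a::{real_inner, complete_space} \<Rightarrow> 'b::{real_inner, complete_space})
    \<Rightarrow> real \<Rightarrow> 'b \<Rightarrow> nat \<Rightarrow> 'a" where
  "SINE s T \<gamma> b m =
     (if m = 0 then 0 else arg_min_on (\<lambda>x. norm (b - T x)) (SINE_space s T \<gamma> b m))"

text \<open>
  The stopping index is \<open>\<infinity>\<close> if the discrepancy principle is never satisfied.
\<close>

definition stopping_index ::
  "('a \<Rightarrow> 'b::real_normed_vector) \<Rightarrow> real \<Rightarrow> real \<Rightarrow> 'b \<Rightarrow> (nat \<Rightarrow> 'a) \<Rightarrow> enat" where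
  "stopping_index T \<tau> \<delta> b x = Inf (enat ` {m. norm (b - T (x m)) \<le> \<tau> * \<delta>})"

end

theory Submission
  imports Defs
begin

text \<open>
  Applying \<open>(I + T T* / \<gamma>)\<^sup>-\<^sup>1\<close> to a residual never increases its norm, and it turns
  the residual of \<open>x\<close> into that of a Tikhonov step from \<open>x\<close>. Since the resolvent
  \<open>R = (I + T* T / \<gamma>)\<^sup>-\<^sup>1\<close> satisfies \<open>R T* T = \<gamma> (I - R)\<close>, after \<open>m - 1\<close> such steps a point of
  the polynomial space of CGNE has moved into the rational space of SINE. So the SINE residual is
  at most the CGNE residual for every \<open>m\<close>. CGNE terminates because its residual is at most that
  of the Landweber iteration, which drops below \<open>\<delta> + \<epsilon>\<close> for every \<open>\<epsilon> > 0\<close>.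
\<close>

section \<open>Quadratic minimisation and adjoints\<close>

text \<open>
  The functional \<open>x \<bullet> x + c * (T x \<bullet> T x) - 2 * f x\<close> is uniformly convex; the equation is the
  Euler equation of its minimiser. For \<open>c = 0\<close> this is the Riesz representation theorem, and
  for \<open>c > 0\<close> it makes \<open>I + c T* T\<close> surjective.
\<close>

lemma quadratic_minimiser:
  fixes T :: "'a::{real_inner, complete_space} \<Rightarrow> 'b::real_inner"
  assumes T: "bounded_linear T" and f: "bounded_linear f" and c: "0 \<le> c"
  obtains x where "\<And>h. x \<bullet> h + c * (T x \<bullet> T h) = f h"
proof -
  interpret T: bounded_linear T by (rule T)
  interpret f: bounded_linear f by (rule f)
  define J where "J = (\<lambda>x. x \<bullet> x + c * (T x \<bullet> T x) - 2 * f x)"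
  obtain K where K: "\<And>x. norm (f x) \<le> norm x * K" using f.bounded by blast
  have "- (K\<^sup>2) \<le> J x" for x
  proof -
    have "0 \<le> (norm x - K)\<^sup>2" by simp
    then have "- (K\<^sup>2) \<le> x \<bullet> x - 2 * (norm x * K)"
      by (simp add: power2_diff power2_norm_eq_inner [symmetric])
    moreover have "f x \<le> norm x * K" using K [of x] by simp
    moreover have "0 \<le> c * (T x \<bullet> T x)" using c by simp
    ultimately show ?thesis unfolding J_def by linarith
  qed
  then have bdd: "bdd_below (range J)" by (meson bdd_belowI2)
  define I where "I = Inf (range J)"
  have I: "I \<le> J x" for x unfolding I_def using bdd by (simp add: cINF_lower)
  have "\<exists>x. J x < I + 1 / real (Suc n)" for n
    using cInf_lessD [of "range J" "I + 1 / real (Suc n)"] unfolding I_def by auto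
  then obtain u where u: "\<And>n. J (u n) < I + 1 / real (Suc n)" by metis
  \<comment> \<open>Parallelogram law at the midpoint \<open>?m\<close>, where \<open>J\<close> is
    at least \<open>I\<close>: two near-minimisers are close, so the minimising sequence
    \<open>u\<close> is Cauchy.\<close>
  have conv: "(norm (v - w))\<^sup>2 \<le> 2 * (J v + J w - 2 * I)" for v w
  proof -
    let ?m = "(1/2) *\<^sub>R (v + w)"
    have "J v + J w - 2 * J ?m = ((v - w) \<bullet> (v - w) + c * (T (v - w) \<bullet> T (v - w))) / 2"
      unfolding J_def T.scaleR T.add T.diff f.scaleR f.add
      by (simp add: inner_simps inner_commute field_simps)
    moreover have "0 \<le> c * (T (v - w) \<bullet> T (v - w))" using c by simp
    ultimately show ?thesis
      using I [of ?m] by (simp add: power2_norm_eq_inner)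
  qed
  have "Cauchy u"
  proof (rule metric_CauchyI)
    fix e :: real assume e: "0 < e"
    define q where "q = e\<^sup>2 / 4"
    have "0 < q" using e by (simp add: q_def)
    then obtain N where N: "1 / real (Suc N) < q" by (rule nat_approx_posE)
    have small: "J (u n) < I + q" if "N \<le> n" for n
    proof -
      have "1 / real (Suc n) \<le> 1 / real (Suc N)" using that by (simp add: frac_le)
      then show ?thesis using u [of n] N by linarith
    qed
    have "dist (u m) (u n) < e" if "N \<le> m" "N \<le> n" for m n
    proof -
      have "(norm (u m - u n))\<^sup>2 < 4 * q"
        using conv [of "u m" "u n"] small [OF that(1)] small [OF that(2)] by argo
      then show ?thesis using e by (simp add: q_def dist_norm power_less_imp_less_base)
    qed
    then show "\<exists>N. \<forall>m\<ge>N. \<forall>n\<ge>N. dist (u m) (u n) < e" by blast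
  qed
  then obtain x where x: "u \<longlonglongrightarrow> x" using Cauchy_convergent_iff convergent_def by blast
  have "(\<lambda>n. J (u n)) \<longlonglongrightarrow> J x"
    unfolding J_def by (intro tendsto_intros T.tendsto f.tendsto x)
  moreover have "(\<lambda>n. I + 1 / real (Suc n)) \<longlonglongrightarrow> I + 0"
    by (intro tendsto_intros LIMSEQ_Suc lim_1_over_n)
  ultimately have "J x \<le> I + 0"
    using u by (intro LIMSEQ_le) (auto intro: less_imp_le)
  then have min: "J x \<le> J z" for z using I [of z] by simp
  have "x \<bullet> h + c * (T x \<bullet> T h) = f h" for h
  proof (rule ccontr)
    define g where "g = x \<bullet> h + c * (T x \<bullet> T h) - f h"
    define q where "q = h \<bullet> h + c * (T h \<bullet> T h)"
    assume "\<not> ?thesis"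
    then have g: "0 < g\<^sup>2" by (simp add: g_def)
    have q: "0 \<le> q" using c by (simp add: q_def)
    \<comment> \<open>The exact minimiser along \<open>h\<close> would be \<open>- g / q\<close>;
      the \<open>+ 1\<close> covers \<open>q = 0\<close> and still makes \<open>J\<close> drop
      strictly.\<close>
    define r where "r = - g / (q + 1)"
    have "J (x + r *\<^sub>R h) = J x + 2 * r * g + r\<^sup>2 * q"
      unfolding J_def g_def q_def T.scaleR T.add f.scaleR f.add
      by (simp add: inner_simps inner_commute power2_eq_square algebra_simps)
    then have "0 \<le> 2 * r * g + r\<^sup>2 * q" using min [of "x + r *\<^sub>R h"] by simp
    also have "2 * r * g + r\<^sup>2 * q = - (g\<^sup>2 * (q + 2) / (q + 1)\<^sup>2)"
      using q unfolding r_def by (simp add: divide_simps) (simp add: power2_eq_square algebra_simps)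
    also have "\<dots> < 0" using g q by (simp add: zero_less_mult_iff divide_pos_pos)
    finally show False by simp
  qed
  then show thesis using that by blast
qed

text \<open>\<open>adjoint\<close> is a choice, so it is correct as soon as some adjoint exists;
  \<open>quadratic_minimiser\<close> with \<open>c = 0\<close> represents each functional
  \<open>\<lambda>x. T x \<bullet> y\<close>.\<close>

lemma bounded_linear_adjoint_works:
  fixes T :: "'a::{real_inner, complete_space} \<Rightarrow> 'b::real_inner"
  assumes "bounded_linear T"
  shows "T x \<bullet> y = x \<bullet> adjoint T y"
proof -
  have "\<exists>z. \<forall>x. T x \<bullet> y = x \<bullet> z" for y
  proof -
    have "bounded_linear (\<lambda>x. T x \<bullet> y)"
      using assms bounded_linear_compose [OF bounded_linear_inner_left] by blast
    from quadratic_minimiser [OF assms this order_refl]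
    show ?thesis by (metis add.right_neutral inner_commute mult_zero_left)
  qed
  then obtain g where g: "\<forall>x y. T x \<bullet> y = x \<bullet> g y" by metis
  then show ?thesis using adjoint_unique [OF g] by simp
qed

lemma continuous_linear_imp_bounded_linear:
  fixes T :: "'a::real_normed_vector \<Rightarrow> 'b::real_normed_vector"
  assumes "linear T" and "continuous_on UNIV T"
  shows "bounded_linear T"
proof -
  interpret T: linear T by (rule assms(1))
  from assms(2) have "isCont T 0" by (simp add: continuous_on_eq_continuous_at)
  then obtain d where d: "0 < d" "\<And>x. norm x < d \<Longrightarrow> norm (T x) < 1"
    unfolding continuous_at_eps_delta dist_norm by (metis T.zero diff_zero zero_less_one)
  have "norm (T x) \<le> norm x * (2 / d)" for x
  proof (cases "x = 0")
    case False
    define r where "r = d / (2 * norm x)"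
    have r: "0 < r" using d(1) False by (simp add: r_def)
    have "norm (r *\<^sub>R x) < d" using d(1) False by (simp add: r_def)
    then have "norm (T (r *\<^sub>R x)) < 1" by (rule d(2))
    then have "r * norm (T x) < 1" using r by (simp add: T.scale)
    then show ?thesis using d(1) False by (simp add: r_def field_simps)
  qed simp
  then show ?thesis by (intro bounded_linear_intro T.add T.scale)
qed

section \<open>Best approximation in finite-dimensional spaces\<close>

lemma best_approximation_in_span:
  fixes F :: "'a::real_inner set"
  assumes "finite F"
  obtains w where "w \<in> span F" and "\<And>v. v \<in> span F \<Longrightarrow> norm (b - w) \<le> norm (b - v)"
proof -
  obtain C where C: "finite C" "span C = span F" "pairwise orthogonal C"
    using basis_orthogonal [OF assms] by blast
  \<comment> \<open>The orthogonal projection of \<open>b\<close>. If \<open>0\<close> lies in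
    \<open>C\<close>, division by zero makes its coefficient \<open>0\<close>, so no separate case
    arises.\<close>
  define w where "w = (\<Sum>c\<in>C. (b \<bullet> c / (c \<bullet> c)) *\<^sub>R c)"
  have w: "w \<in> span F" unfolding w_def C(2) [symmetric]
    by (intro span_sum span_scale span_base)
  have orth: "(b - w) \<bullet> c = 0" if c: "c \<in> C" for c
  proof -
    have "w \<bullet> c = (\<Sum>d\<in>C. if d = c then b \<bullet> c else 0)"
      unfolding w_def inner_sum_left
      using C(3) c by (intro sum.cong) (auto simp: pairwise_def orthogonal_def)
    then show ?thesis using C(1) c by (simp add: inner_diff_left)
  qed
  have orth': "(b - w) \<bullet> v = 0" if "v \<in> span F" for v
    using orth that orthogonal_to_span [of v C "b - w"] C(2)
    by (auto simp: orthogonal_def)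
  have "norm (b - w) \<le> norm (b - v)" if v: "v \<in> span F" for v
  proof -
    have "(b - w) \<bullet> (w - v) = 0" using orth' span_diff [OF w v] by blast
    then have "(norm (b - v))\<^sup>2 = (norm (b - w))\<^sup>2 + (norm (w - v))\<^sup>2"
      using norm_add_Pythagorean [of "b - w" "w - v"] by (simp add: orthogonal_def)
    then have "(norm (b - w))\<^sup>2 \<le> (norm (b - v))\<^sup>2" by simp
    then show ?thesis by (rule power2_le_imp_le) simp
  qed
  with w show thesis using that by blast
qed

text \<open>If \<open>i * i = - 1\<close>, multiplication by \<open>i\<close> is an isometry,
  preserves the inner product by polarisation, and is therefore skew. For \<open>i = 0\<close> both
  sides vanish.\<close>

lemma inner_scale_imaginary:
  fixes s :: "'k::real_or_complex \<Rightarrow> 'a::{real_inner, complete_space} \<Rightarrow> 'a"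
  assumes "hilbert_space_over s" and i: "i = 0 \<or> i * i = - 1"
  shows "s i x \<bullet> y = - (x \<bullet> s i y)"
proof -
  interpret vector_space s using assms by (simp add: hilbert_space_over_def)
  show ?thesis
  proof (cases "i = 0")
    case False
    then have ii: "i * i = - 1" using i by blast
    then have "norm i * norm i = 1" by (metis norm_minus_cancel norm_mult norm_one)
    then have "norm i = 1"
      by (metis norm_ge_zero power2_eq_square power2_eq_1_iff neg_0_le_iff_le not_one_le_zero)
    then have n: "norm (s i z) = norm z" for z
      using assms by (simp add: hilbert_space_over_def)
    have iso: "s i u \<bullet> s i v = u \<bullet> v" for u v
      using n [of "u + v"] n [of u] n [of v]
      by (simp add: dot_norm scale_right_distrib [symmetric])
    have "s i (s i x) = - x" by (simp add: ii)
    then show ?thesis using iso [of "s i x" y] by simp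
  qed simp
qed

lemma norm_diff_scaleR_power2:
  fixes x y :: "'a::real_inner"
  shows "(norm (x - r *\<^sub>R y))\<^sup>2 = (norm x)\<^sup>2 - 2 * r * (x \<bullet> y) + r * (r * (norm y)\<^sup>2)"
  unfolding power2_norm_eq_inner
  by (simp add: inner_diff_left inner_diff_right inner_commute algebra_simps)

section \<open>Continuous operators between Hilbert spaces\<close>

locale hilbert_operator =
  fixes s :: "'k::real_or_complex \<Rightarrow> 'a::{real_inner, complete_space} \<Rightarrow> 'a"
    and t :: "'k \<Rightarrow> 'b::{real_inner, complete_space} \<Rightarrow> 'b"
    and T :: "'a \<Rightarrow> 'b"
  assumes X: "hilbert_space_over s" and Y: "hilbert_space_over t"
    and lin: "Vector_Spaces.linear s t T" and cont: "continuous_on UNIV T"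
begin

sublocale X: vector_space s
  using X by (simp add: hilbert_space_over_def)

sublocale Y: vector_space t
  using Y by (simp add: hilbert_space_over_def)

abbreviation adj where "adj \<equiv> adjoint T"

lemma scale_of_real: "s (of_real r) x = r *\<^sub>R x" "t (of_real r) y = r *\<^sub>R y"
  using X Y by (auto simp: hilbert_space_over_def)

lemma T_scale: "T (s c x) = t c (T x)"
  using lin by (simp add: Vector_Spaces.linear_iff)

sublocale T: bounded_linear T
proof (rule continuous_linear_imp_bounded_linear)
  have "T (r *\<^sub>R x) = r *\<^sub>R T x" for r x
    using T_scale [of "of_real r" x] by (simp add: scale_of_real)
  then show "linear T"
    using lin by (intro linearI) (auto simp: Vector_Spaces.linear_iff)
qed (rule cont)

lemma adj: "T x \<bullet> y = x \<bullet> adj y"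
  by (rule bounded_linear_adjoint_works) (rule T.bounded_linear_axioms)

lemma adj_eqI: "(\<And>x. T x \<bullet> y = x \<bullet> z) \<Longrightarrow> adj y = z"
  by (metis adj inner_commute vector_eq_rdot)

lemma adj_add: "adj (x + y) = adj x + adj y"
  by (rule adj_eqI) (simp add: adj inner_add_right)

lemma adj_scaleR: "adj (r *\<^sub>R y) = r *\<^sub>R adj y"
  by (rule adj_eqI) (simp add: adj)

sublocale adj: linear adj
  by (intro linearI adj_add adj_scaleR)

text \<open>\<open>adjoint\<close> only knows the real inner product. Scalars are
  \<open>a + b * i\<close>, and \<open>i\<close> changes sign when it crosses the inner product in
  either space, so the two signs cancel.\<close>

lemma adj_scale: "adj (t c y) = s c (adj y)"
proof -
  obtain i :: 'k where i: "i = 0 \<or> i * i = - 1" and "\<forall>c. \<exists>a b. c = a *\<^sub>R 1 + b *\<^sub>R i"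
    using real_or_complex by blast
  then obtain a b where "c = a *\<^sub>R 1 + b *\<^sub>R i" by blast
  then have c: "c = of_real a + of_real b * i" by (simp add: scaleR_conv_of_real)
  have adj_i: "adj (t i y) = s i (adj y)" for y
  proof (rule adj_eqI)
    fix x
    have "T x \<bullet> t i y = - (t i (T x) \<bullet> y)" using inner_scale_imaginary [OF Y i] by simp
    also have "\<dots> = - (s i x \<bullet> adj y)" by (simp add: T_scale [symmetric] adj)
    also have "\<dots> = x \<bullet> s i (adj y)" using inner_scale_imaginary [OF X i] by simp
    finally show "T x \<bullet> t i y = x \<bullet> s i (adj y)" .
  qed
  then show ?thesis
    unfolding c X.scale_left_distrib Y.scale_left_distrib
      X.scale_scale [symmetric] Y.scale_scale [symmetric]
    by (simp only: scale_of_real adj_add adj_scaleR adj_i)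
qed

lemma adj_bound: "norm (adj y) \<le> onorm T * norm y"
proof (cases "adj y = 0")
  case False
  have "(norm (adj y))\<^sup>2 = T (adj y) \<bullet> y" by (simp add: adj power2_norm_eq_inner)
  also have "\<dots> \<le> norm (T (adj y)) * norm y" by (rule norm_cauchy_schwarz)
  also have "\<dots> \<le> onorm T * norm (adj y) * norm y"
    by (intro mult_right_mono onorm T.bounded_linear_axioms) simp
  finally show ?thesis using False by (simp add: power2_eq_square mult.commute mult.left_commute)
qed (simp add: onorm_pos_le T.bounded_linear_axioms)

section \<open>Existence of the minimisers\<close>

lemma subspace_imp_real_subspace: "X.subspace V \<Longrightarrow> subspace V"
  unfolding X.subspace_def by (intro subspaceI) (auto simp: scale_of_real(1) [symmetric])

text \<open>Adjoining the \<open>i\<close>-multiples of the generators makes the real span closed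
  under all scalars. This reduces best approximation over \<open>'k\<close> to the real
  case.\<close>

lemma span_eq_real_span:
  assumes "finite F"
  obtains G where "finite G" and "X.span F = span G"
proof -
  obtain i :: 'k where i: "i = 0 \<or> i * i = - 1" and dec: "\<forall>c. \<exists>a b. c = a *\<^sub>R 1 + b *\<^sub>R i"
    using real_or_complex by blast
  define G where "G = F \<union> s i ` F"
  have si: "s i x \<in> span G" if "x \<in> span G" for x
    using that
  proof (induction rule: span_induct_alt)
    case base
    then show ?case by (simp add: span_zero)
  next
    case (step r x y)
    have "s i x \<in> span G"
    proof (cases "x \<in> F")
      case True
      then show ?thesis by (auto simp: G_def intro: span_base)
    next
      case False
      then obtain z where z: "z \<in> F" "x = s i z" using step(1) by (auto simp: G_def)
      then have "s i x = 0 \<or> s i x = - z" using i by auto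
      moreover have "z \<in> span G" using z by (simp add: G_def span_base)
      ultimately show ?thesis by (auto simp: span_zero span_neg)
    qed
    moreover have "s i (r *\<^sub>R x) = r *\<^sub>R s i x"
      by (metis X.scale_left_commute scale_of_real(1))
    ultimately show ?case using step(2)
      by (simp add: X.scale_right_distrib span_add span_scale)
  qed
  have "s c x \<in> span G" if "x \<in> span G" for c x
  proof -
    obtain a b where "c = a *\<^sub>R 1 + b *\<^sub>R i" using dec by blast
    then have c: "c = of_real a + of_real b * i" by (simp add: scaleR_conv_of_real)
    show ?thesis using that si [OF that]
      unfolding c X.scale_left_distrib X.scale_scale [symmetric] scale_of_real
      by (intro span_add span_scale)
  qed
  then have "X.subspace (span G)" by (intro X.subspaceI) (auto intro: span_zero span_add)
  then have "X.span F \<subseteq> span G"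
    by (intro X.span_minimal) (auto simp: G_def span_base)
  moreover have "span G \<subseteq> X.span F"
    by (intro span_minimal subspace_imp_real_subspace X.subspace_span)
      (auto simp: G_def intro: X.span_base X.span_scale)
  moreover have "finite G" using assms by (simp add: G_def)
  ultimately show thesis using that by blast
qed

text \<open>\<open>arg_min_on\<close> minimises only if a minimum is attained. Here it is:
  \<open>b\<close> has a best approximation in the finite-dimensional image of the span.\<close>

lemma arg_min_residual:
  fixes b :: 'b
  assumes "finite F"
  defines "z \<equiv> arg_min_on (\<lambda>x. norm (b - T x)) (X.span F)"
  shows "z \<in> X.span F" and "x \<in> X.span F \<Longrightarrow> norm (b - T z) \<le> norm (b - T x)"
proof -
  obtain G where G: "finite G" "X.span F = span G" using span_eq_real_span [OF assms(1)] .
  obtain w where w: "w \<in> span (T ` G)" "\<And>v. v \<in> span (T ` G) \<Longrightarrow> norm (b - w) \<le> norm (b - v)"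
    using best_approximation_in_span [of "T ` G" b] G(1) by blast
  have im: "span (T ` G) = T ` span G" using linear_span_image [OF T.linear_axioms] .
  then obtain u where u: "u \<in> span G" "w = T u" using w(1) by blast
  have "is_arg_min (\<lambda>x. norm (b - T x)) (\<lambda>x. x \<in> X.span F) u"
    using u w(2) unfolding is_arg_min_def G(2) im by (auto simp: not_less)
  then have "is_arg_min (\<lambda>x. norm (b - T x)) (\<lambda>x. x \<in> X.span F) z"
    unfolding z_def arg_min_on_def arg_min_def by (rule someI)
  then show "z \<in> X.span F" and "x \<in> X.span F \<Longrightarrow> norm (b - T z) \<le> norm (b - T x)"
    by (auto simp: is_arg_min_def not_less)
qed

text \<open>For \<open>m = 0\<close> the space is the span of the empty set, which contains only
  \<open>0\<close>, in accordance with the starting iterate.\<close>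

lemma CGNE_residual_le:
  assumes "x \<in> CGNE_space s T b m"
  shows "norm (b - T (CGNE s T b m)) \<le> norm (b - T x)"
  using assms arg_min_residual(2)
  by (cases "m = 0") (simp_all add: CGNE_def CGNE_space_def krylov_space_def)

lemma SINE_residual_le:
  assumes "x \<in> SINE_space s T \<gamma> b m"
  shows "norm (b - T (SINE s T \<gamma> b m)) \<le> norm (b - T x)"
  using assms arg_min_residual(2)
  by (cases "m = 0") (simp_all add: SINE_def SINE_space_def krylov_space_def)

lemma CGNE_in_space: "CGNE s T b m \<in> CGNE_space s T b m"
  using arg_min_residual(1)
  by (cases "m = 0") (simp_all add: CGNE_def CGNE_space_def krylov_space_def)

end

section \<open>Krylov spaces\<close>

context hilbert_operator
begin

lemma subspace_krylov_space: "X.subspace (krylov_space s A v m)"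
  by (simp add: krylov_space_def)

lemmas krylov_space_zero = X.subspace_0 [OF subspace_krylov_space]
  and krylov_space_add = X.subspace_add [OF subspace_krylov_space]
  and krylov_space_diff = X.subspace_diff [OF subspace_krylov_space]

lemma krylov_space_scaleR:
  "x \<in> krylov_space s A v m \<Longrightarrow> r *\<^sub>R x \<in> krylov_space s A v m"
  using X.subspace_scale [OF subspace_krylov_space, of x A v m "of_real r"]
  by (simp add: scale_of_real)

lemma krylov_space_base: "j < m \<Longrightarrow> (A ^^ j) v \<in> krylov_space s A v m"
  unfolding krylov_space_def by (intro X.span_base) simp

lemma krylov_space_Suc: "x \<in> krylov_space s A v m \<Longrightarrow> x \<in> krylov_space s A v (Suc m)"
  unfolding krylov_space_def by (erule set_mp [OF X.span_mono, rotated]) auto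

text \<open>Stated for any linear \<open>A\<close> because it serves both \<open>T* T\<close> and
  the resolvent.\<close>

lemma krylov_space_map:
  assumes add: "\<And>x y. A (x + y) = A x + A y" and scale: "\<And>c x. A (s c x) = s c (A x)"
    and x: "x \<in> krylov_space s A v m"
  shows "A x \<in> krylov_space s A v (Suc m)"
  using x unfolding krylov_space_def
proof (induction rule: X.span_induct_alt)
  case base
  have "A 0 = 0" using add [of 0 0] by simp
  then show ?case by (simp add: X.span_zero)
next
  case (step c x y)
  then obtain j where "j < m" "x = (A ^^ j) v" by auto
  then have "A x \<in> krylov_space s A v (Suc m)"
    using krylov_space_base [of "Suc j" "Suc m" A v] by simp
  then have "A x \<in> X.span ((\<lambda>j. (A ^^ j) v) ` {..<Suc m})"
    unfolding krylov_space_def .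
  then show ?case using step(2) unfolding add scale by (intro X.span_add X.span_scale)
qed

lemma CGNE_space_map:
  "x \<in> CGNE_space s T b m \<Longrightarrow> adj (T x) \<in> CGNE_space s T b (Suc m)"
  unfolding CGNE_space_def by (rule krylov_space_map) (simp_all add: T.add adj_add T_scale adj_scale)

end

section \<open>CGNE terminates\<close>

context hilbert_operator
begin

text \<open>
  The Landweber iterates \<open>x\<close> lie in the Krylov spaces. Their residual splits into the damped
  data error \<open>d\<close> and \<open>T e\<close>, where the energy inequality
  \<open>w * norm (T e)^2 \<le> norm e^2 - norm e'^2\<close> for successive \<open>e\<close>, \<open>e'\<close> forces \<open>T e\<close> to become small.
\<close>

lemma CGNE_residual_eventually_small:
  assumes noise: "norm (b - T x\<^sub>0) \<le> \<delta>" and \<epsilon>: "0 < \<epsilon>"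
  obtains m where "norm (b - T (CGNE s T b m)) \<le> \<delta> + \<epsilon>"
proof -
  \<comment> \<open>The Landweber step size; the \<open>+ 1\<close> keeps it well defined even if
    \<open>onorm T = 0\<close>.\<close>
  define w where "w = 1 / ((onorm T)\<^sup>2 + 1)"
  have w: "0 < w" unfolding w_def by (simp add: add_nonneg_pos)
  have wK: "w * (onorm T)\<^sup>2 \<le> 1" unfolding w_def by (simp add: add_nonneg_pos)
  \<comment> \<open>The types are left open because this is used once for \<open>T\<close> and once
    for its adjoint.\<close>
  have damp: "w * (norm z)\<^sup>2 \<le> (norm u)\<^sup>2" if "norm z \<le> onorm T * norm u"
    for z :: "'c::real_normed_vector" and u :: "'d::real_normed_vector"
  proof -
    have "w * (norm z)\<^sup>2 \<le> w * (onorm T * norm u)\<^sup>2"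
      using that w by (intro mult_left_mono power_mono) auto
    also have "\<dots> = (w * (onorm T)\<^sup>2) * (norm u)\<^sup>2" by (simp add: power_mult_distrib)
    also have "\<dots> \<le> 1 * (norm u)\<^sup>2" by (intro mult_right_mono wK) simp
    finally show ?thesis by simp
  qed
  \<comment> \<open>\<open>d\<close> propagates the data error by \<open>I - w T T*\<close>, and
    \<open>e\<close> propagates the initial error \<open>x\<^sub>0 - 0\<close> by
    \<open>I - w T* T\<close>.\<close>
  define x where "x = (\<lambda>k. ((\<lambda>x. x + w *\<^sub>R adj (b - T x)) ^^ k) 0)"
  define d where "d = (\<lambda>k. ((\<lambda>d. d - w *\<^sub>R T (adj d)) ^^ k) (b - T x\<^sub>0))"
  define e where "e = (\<lambda>k. ((\<lambda>e. e - w *\<^sub>R adj (T e)) ^^ k) x\<^sub>0)"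
  have rec: "x (Suc k) = x k + w *\<^sub>R adj (b - T (x k))" "d (Suc k) = d k - w *\<^sub>R T (adj (d k))"
    "e (Suc k) = e k - w *\<^sub>R adj (T (e k))" for k
    by (simp_all add: x_def d_def e_def)
  have space: "x k \<in> CGNE_space s T b k" for k
  proof (induction k)
    case 0
    then show ?case by (simp add: x_def CGNE_space_def krylov_space_zero)
  next
    case (Suc k)
    have "adj b \<in> CGNE_space s T b (Suc k)"
      unfolding CGNE_space_def using krylov_space_base [of 0] by simp
    then show ?case
      using Suc CGNE_space_map [OF Suc] unfolding rec adj.diff CGNE_space_def
      by (intro krylov_space_add krylov_space_scaleR krylov_space_diff) (auto intro: krylov_space_Suc)
  qed
  have residual: "b - T (x k) = d k + T (e k)" for k
  proof (induction k)
    case 0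
    then show ?case by (simp add: x_def d_def e_def)
  next
    case (Suc k)
    have "b - T (x (Suc k)) = (b - T (x k)) - w *\<^sub>R T (adj (b - T (x k)))"
      by (simp add: rec T.add T.scaleR)
    then show ?case unfolding Suc by (simp add: rec T.add T.diff T.scaleR adj_add scaleR_add_right)
  qed
  \<comment> \<open>By \<open>damp\<close> the quadratic term is at most half of the cross term, so
    a step never amplifies the noise.\<close>
  have d: "norm (d k) \<le> \<delta>" for k
  proof (induction k)
    case 0
    then show ?case using noise by (simp add: d_def)
  next
    case (Suc k)
    let ?d = "d k"
    have "(norm (d (Suc k)))\<^sup>2 = (norm ?d)\<^sup>2 - 2 * w * (norm (adj ?d))\<^sup>2 + w * (w * (norm (T (adj ?d)))\<^sup>2)"
      unfolding rec norm_diff_scaleR_power2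
      by (simp add: inner_commute [of ?d "T (adj ?d)"] adj power2_norm_eq_inner)
    also have "\<dots> \<le> (norm ?d)\<^sup>2 - 2 * w * (norm (adj ?d))\<^sup>2 + w * (norm (adj ?d))\<^sup>2"
      using damp [OF onorm [OF T.bounded_linear_axioms], of "adj ?d"] w by simp
    also have "\<dots> \<le> (norm ?d)\<^sup>2" using w by simp
    finally show ?case using Suc by (smt (verit) norm_ge_zero power2_le_imp_le)
  qed
  have e: "w * (norm (T (e k)))\<^sup>2 \<le> (norm (e k))\<^sup>2 - (norm (e (Suc k)))\<^sup>2" for k
  proof -
    let ?e = "e k"
    have "(norm (e (Suc k)))\<^sup>2 = (norm ?e)\<^sup>2 - 2 * w * (norm (T ?e))\<^sup>2 + w * (w * (norm (adj (T ?e)))\<^sup>2)"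
      unfolding rec norm_diff_scaleR_power2
      by (simp add: adj [symmetric] power2_norm_eq_inner)
    also have "\<dots> \<le> (norm ?e)\<^sup>2 - 2 * w * (norm (T ?e))\<^sup>2 + w * (norm (T ?e))\<^sup>2"
      using damp [OF adj_bound, of "T ?e"] w by simp
    finally show ?thesis by simp
  qed
  \<comment> \<open>Otherwise every step would take at least \<open>w * \<epsilon>\<^sup>2\<close>
    from the squared norm of \<open>e\<close>, and the telescoped loss would exceed its initial
    value.\<close>
  have "\<exists>k. norm (T (e k)) \<le> \<epsilon>"
  proof (rule ccontr)
    assume "\<nexists>k. norm (T (e k)) \<le> \<epsilon>"
    then have big: "w * \<epsilon>\<^sup>2 \<le> w * (norm (T (e k)))\<^sup>2" for k
      using \<epsilon> w by (intro mult_left_mono power_mono) (auto simp: not_le less_imp_le)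
    have sum: "real n * (w * \<epsilon>\<^sup>2) \<le> (norm (e 0))\<^sup>2 - (norm (e n))\<^sup>2" for n
    proof (induction n)
      case (Suc n)
      then show ?case using e [of n] big [of n] by (simp add: algebra_simps)
    qed simp
    have "0 < w * \<epsilon>\<^sup>2" using w \<epsilon> by simp
    then obtain n where "(norm (e 0))\<^sup>2 < real n * (w * \<epsilon>\<^sup>2)"
      using reals_Archimedean3 by blast
    then show False using sum [of n] by (smt (verit) zero_le_power2)
  qed
  then obtain k where "norm (T (e k)) \<le> \<epsilon>" ..
  then have "norm (b - T (x k)) \<le> \<delta> + \<epsilon>"
    unfolding residual by (rule norm_triangle_mono [OF d])
  with CGNE_residual_le [OF space] have "norm (b - T (CGNE s T b k)) \<le> \<delta> + \<epsilon>"
    by (rule order_trans)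
  then show thesis by (rule that)
qed

end

section \<open>Comparison of the residuals\<close>

locale regularised_operator = hilbert_operator +
  fixes \<gamma> :: real
  assumes \<gamma>: "0 < \<gamma>"
begin

section \<open>The resolvent of \<open>T* T\<close>\<close>

definition resolvent where "resolvent = inv (\<lambda>x. x + (1 / \<gamma>) *\<^sub>R adj (T x))"

text \<open>\<open>inv\<close> yields a preimage once the map is surjective; solving for a preimage
  of \<open>x\<close> is the Euler equation with \<open>c = 1 / \<gamma>\<close> and the functional
  \<open>\<lambda>h. x \<bullet> h\<close>.\<close>

lemma resolvent_eq: "resolvent x + (1 / \<gamma>) *\<^sub>R adj (T (resolvent x)) = x"
proof -
  have "\<exists>z. x = z + (1 / \<gamma>) *\<^sub>R adj (T z)" for x
  proof -
    have "0 \<le> 1 / \<gamma>" using \<gamma> by simp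
    then obtain z where z: "\<And>h. z \<bullet> h + (1 / \<gamma>) * (T z \<bullet> T h) = x \<bullet> h"
      by (rule quadratic_minimiser [OF T.bounded_linear_axioms bounded_linear_inner_right [of x]]) blast
    have "h \<bullet> x = h \<bullet> (z + (1 / \<gamma>) *\<^sub>R adj (T z))" for h
      using z [of h] adj [of h "T z"]
      by (simp add: inner_add_right inner_commute [of _ h] inner_commute [of "T z"])
    then have "x = z + (1 / \<gamma>) *\<^sub>R adj (T z)" by (subst vector_eq_ldot [symmetric]) blast
    then show ?thesis ..
  qed
  then have "surj (\<lambda>x. x + (1 / \<gamma>) *\<^sub>R adj (T x))" unfolding surj_def ..
  then show ?thesis unfolding resolvent_def by (rule surj_f_inv_f)
qed

text \<open>Injectivity by coercivity: pairing the equation for the difference \<open>v\<close> of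
  two solutions with \<open>v\<close> gives a vanishing sum of nonnegative terms.\<close>

lemma resolvent_eqI:
  assumes "z + (1 / \<gamma>) *\<^sub>R adj (T z) = x"
  shows "resolvent x = z"
proof -
  define v where "v = resolvent x - z"
  have "v + (1 / \<gamma>) *\<^sub>R adj (T v) = 0"
    using assms resolvent_eq [of x]
    by (simp add: v_def T.diff adj.diff scaleR_diff_right algebra_simps)
  then have "v \<bullet> v + (1 / \<gamma>) * (T v \<bullet> T v) = 0"
    by (metis adj inner_add_right inner_scaleR_right inner_zero_right)
  then have "v \<bullet> v = 0" using \<gamma> by (simp add: add_nonneg_eq_0_iff)
  then show ?thesis by (simp add: v_def)
qed

lemma resolvent_add: "resolvent (x + y) = resolvent x + resolvent y"
proof (rule resolvent_eqI)
  have "resolvent x + resolvent y + (1 / \<gamma>) *\<^sub>R adj (T (resolvent x + resolvent y))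
      = (resolvent x + (1 / \<gamma>) *\<^sub>R adj (T (resolvent x)))
        + (resolvent y + (1 / \<gamma>) *\<^sub>R adj (T (resolvent y)))"
    by (simp add: T.add adj_add scaleR_add_right)
  then show "resolvent x + resolvent y + (1 / \<gamma>) *\<^sub>R adj (T (resolvent x + resolvent y)) = x + y"
    unfolding resolvent_eq .
qed

lemma resolvent_scale: "resolvent (s c x) = s c (resolvent x)"
proof (rule resolvent_eqI)
  have "s c (resolvent x) + s (of_real (1 / \<gamma>)) (s c (adj (T (resolvent x)))) =
      s c (resolvent x + s (of_real (1 / \<gamma>)) (adj (T (resolvent x))))"
    by (simp only: X.scale_right_distrib X.scale_left_commute)
  then show "s c (resolvent x) + (1 / \<gamma>) *\<^sub>R adj (T (s c (resolvent x))) = s c x"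
    unfolding scale_of_real T_scale adj_scale resolvent_eq .
qed

lemma resolvent_scaleR: "resolvent (r *\<^sub>R x) = r *\<^sub>R resolvent x"
  by (metis resolvent_scale scale_of_real(1))

sublocale resolvent: linear resolvent
  by (intro linearI resolvent_add resolvent_scaleR)

text \<open>Apply \<open>resolvent\<close> to \<open>x + (1 / \<gamma>) *\<^sub>R adj (T x)\<close>,
  which gives back \<open>x\<close>, and solve for the second term.\<close>

lemma resolvent_normal_operator: "resolvent (adj (T x)) = \<gamma> *\<^sub>R (x - resolvent x)"
proof -
  have "resolvent x + (1 / \<gamma>) *\<^sub>R resolvent (adj (T x)) = x"
    using resolvent_eqI [of x "x + (1 / \<gamma>) *\<^sub>R adj (T x)"]
    by (simp add: resolvent_add resolvent_scaleR)
  then have "(1 / \<gamma>) *\<^sub>R resolvent (adj (T x)) = x - resolvent x" by (simp add: algebra_simps)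
  then have "\<gamma> *\<^sub>R (1 / \<gamma>) *\<^sub>R resolvent (adj (T x)) = \<gamma> *\<^sub>R (x - resolvent x)" by simp
  then show ?thesis using \<gamma> by simp
qed

section \<open>Tikhonov steps\<close>

definition tikhonov_step where
  "tikhonov_step b x = resolvent x + (1 / \<gamma>) *\<^sub>R resolvent (adj b)"

text \<open>The step changes the residual \<open>w\<close> to
  \<open>w - (1 / \<gamma>) *\<^sub>R T u\<close>, and the inner product of \<open>T u\<close> with
  \<open>w\<close> is large enough for the cross term to outweigh the quadratic one.\<close>

lemma tikhonov_step_residual_le: "norm (b - T (tikhonov_step b x)) \<le> norm (b - T x)"
proof -
  define w where "w = b - T x"
  define u where "u = resolvent (adj w)"
  have "u = resolvent (adj b) - \<gamma> *\<^sub>R (x - resolvent x)"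
    by (simp add: u_def w_def adj.diff resolvent.diff resolvent_normal_operator)
  then have "tikhonov_step b x = x + (1 / \<gamma>) *\<^sub>R u"
    using \<gamma> by (simp add: tikhonov_step_def scaleR_diff_right)
  then have res: "b - T (tikhonov_step b x) = w - (1 / \<gamma>) *\<^sub>R T u"
    by (simp add: T.add T.scaleR w_def)
  \<comment> \<open>Moving \<open>T\<close> across gives \<open>adj w\<close>, which the defining
    equation of \<open>u\<close> expresses through \<open>u\<close> itself.\<close>
  have "T u \<bullet> w = u \<bullet> (u + (1 / \<gamma>) *\<^sub>R adj (T u))"
    unfolding adj u_def resolvent_eq ..
  then have uw: "T u \<bullet> w = (norm u)\<^sup>2 + (1 / \<gamma>) * (norm (T u))\<^sup>2"
    by (simp add: inner_add_right adj [symmetric] power2_norm_eq_inner)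
  have "(norm (w - (1 / \<gamma>) *\<^sub>R T u))\<^sup>2
      = (norm w)\<^sup>2 - 2 * (1 / \<gamma>) * (T u \<bullet> w) + (1 / \<gamma>) * ((1 / \<gamma>) * (norm (T u))\<^sup>2)"
    unfolding norm_diff_scaleR_power2 inner_commute [of w "T u"] ..
  also have "\<dots> = (norm w)\<^sup>2 - (1 / \<gamma>) * (2 * (norm u)\<^sup>2 + (1 / \<gamma>) * (norm (T u))\<^sup>2)"
    unfolding uw by (simp add: algebra_simps)
  also have "\<dots> \<le> (norm w)\<^sup>2" using \<gamma> by simp
  finally have "norm (w - (1 / \<gamma>) *\<^sub>R T u) \<le> norm w"
    by (rule power2_le_imp_le) simp
  then show ?thesis unfolding res by (simp only: w_def)
qed

lemma tikhonov_iterate_residual_le: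
  "norm (b - T ((tikhonov_step b ^^ n) x)) \<le> norm (b - T x)"
  by (induction n) (auto intro: order_trans [OF tikhonov_step_residual_le])

section \<open>From the polynomial to the rational Krylov space\<close>

lemma SINE_space_eq: "SINE_space s T \<gamma> b m = krylov_space s resolvent (adj b) m"
  by (simp add: SINE_space_def resolvent_def)

lemmas resolvent_krylov = krylov_space_map [of resolvent, OF resolvent_add resolvent_scale]

lemma resolvent_power_linear:
  "(resolvent ^^ n) (x + y) = (resolvent ^^ n) x + (resolvent ^^ n) y"
  "(resolvent ^^ n) (s c x) = s c ((resolvent ^^ n) x)"
  "(resolvent ^^ n) (x - y) = (resolvent ^^ n) x - (resolvent ^^ n) y"
  "(resolvent ^^ n) (r *\<^sub>R x) = r *\<^sub>R (resolvent ^^ n) x"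
  by (induction n)
    (simp_all add: resolvent_add resolvent_scale resolvent.diff resolvent_scaleR)

text \<open>Each factor \<open>T* T\<close> is absorbed by one resolvent and replaced by
  \<open>\<gamma> (I - R)\<close>; since \<open>j \<le> n\<close>, there are enough resolvents, and
  only powers of \<open>R\<close> up to \<open>n\<close> remain.\<close>

lemma resolvent_power_monomial:
  "j \<le> n \<Longrightarrow> (resolvent ^^ n) (((\<lambda>x. adj (T x)) ^^ j) v) \<in> krylov_space s resolvent v (Suc n)"
proof (induction n arbitrary: j)
  case 0
  then show ?case using krylov_space_base [of 0 1 resolvent v] by simp
next
  case (Suc n)
  show ?case
  proof (cases j)
    case 0
    then show ?thesis using krylov_space_base [of "Suc n" "Suc (Suc n)" resolvent v] by simp
  next
    case (Suc i)
    let ?x = "((\<lambda>x. adj (T x)) ^^ i) v"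
    have IH: "(resolvent ^^ n) ?x \<in> krylov_space s resolvent v (Suc n)"
      using Suc.IH [of i] Suc.prems Suc by simp
    have "(resolvent ^^ Suc n) (((\<lambda>x. adj (T x)) ^^ j) v) = (resolvent ^^ n) (resolvent (adj (T ?x)))"
      by (simp add: Suc funpow_swap1)
    also have "\<dots> = \<gamma> *\<^sub>R ((resolvent ^^ n) ?x - resolvent ((resolvent ^^ n) ?x))"
      by (simp add: resolvent_normal_operator resolvent_power_linear funpow_swap1)
    finally show ?thesis
      using krylov_space_Suc [OF IH] resolvent_krylov [OF IH]
      by (simp add: krylov_space_scaleR krylov_space_diff)
  qed
qed

text \<open>The CGNE space of index \<open>Suc n\<close> consists of polynomials of degree at most
  \<open>n\<close> in \<open>T* T\<close>, applied to \<open>adj b\<close>, so \<open>n\<close>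
  resolvents suffice.\<close>

lemma resolvent_power_CGNE_space:
  assumes "x \<in> CGNE_space s T b (Suc n)"
  shows "(resolvent ^^ n) x \<in> SINE_space s T \<gamma> b (Suc n)"
  using assms
  unfolding SINE_space_eq CGNE_space_def krylov_space_def [of s "\<lambda>x. adj (T x)"]
proof (induction rule: X.span_induct_alt)
  case base
  then show ?case using resolvent_power_linear(4) [of n 0 0] by (simp add: krylov_space_zero)
next
  case (step c x y)
  then obtain j where "j < Suc n" and x: "x = ((\<lambda>x. adj (T x)) ^^ j) (adj b)" by blast
  then have j: "j \<le> n" by simp
  show ?case
    unfolding resolvent_power_linear x
    by (intro krylov_space_add X.subspace_scale [OF subspace_krylov_space]
        resolvent_power_monomial [OF j] step)
qed

lemma tikhonov_iterate_in_SINE_space: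
  assumes "x \<in> CGNE_space s T b (Suc n)"
  shows "(tikhonov_step b ^^ n) x \<in> SINE_space s T \<gamma> b (Suc n)"
proof -
  \<comment> \<open>Here \<open>q\<close> collects the data terms: multiples of \<open>R\<close> to
    \<open>R^n\<close> applied to \<open>adj b\<close>. The index is generalised so that the space
    grows with the number of steps.\<close>
  have "\<exists>q \<in> krylov_space s resolvent (adj b) (Suc n).
      (tikhonov_step b ^^ n) x = (resolvent ^^ n) x + q" for n
  proof (induction n)
    case 0
    show ?case using krylov_space_zero by (intro bexI [of _ 0]) auto
  next
    case (Suc n)
    then obtain q where q: "q \<in> krylov_space s resolvent (adj b) (Suc n)"
      "(tikhonov_step b ^^ n) x = (resolvent ^^ n) x + q" by blast
    have "resolvent (adj b) \<in> krylov_space s resolvent (adj b) (Suc (Suc n))"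
      using krylov_space_base [of 1 "Suc (Suc n)" resolvent "adj b"] by simp
    with resolvent_krylov [OF q(1)]
    have "resolvent q + (1 / \<gamma>) *\<^sub>R resolvent (adj b)
        \<in> krylov_space s resolvent (adj b) (Suc (Suc n))"
      by (intro krylov_space_add krylov_space_scaleR)
    moreover have "(tikhonov_step b ^^ Suc n) x
        = (resolvent ^^ Suc n) x + (resolvent q + (1 / \<gamma>) *\<^sub>R resolvent (adj b))"
      unfolding funpow.simps o_apply q(2) tikhonov_step_def resolvent_add add.assoc ..
    ultimately show ?case by blast
  qed
  then show ?thesis
    using resolvent_power_CGNE_space [OF assms] unfolding SINE_space_eq
    by (metis krylov_space_add)
qed

text \<open>SINE competes with the point reached from the CGNE iterate by \<open>m - 1\<close>
  Tikhonov steps; for \<open>m = 0\<close> both iterates are \<open>0\<close>.\<close>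

lemma SINE_residual_le_CGNE_residual:
  "norm (b - T (SINE s T \<gamma> b m)) \<le> norm (b - T (CGNE s T b m))"
proof (cases m)
  case 0
  then show ?thesis by (simp add: SINE_def CGNE_def)
next
  case (Suc n)
  let ?z = "(tikhonov_step b ^^ n) (CGNE s T b (Suc n))"
  have "norm (b - T (SINE s T \<gamma> b (Suc n))) \<le> norm (b - T ?z)"
    by (intro SINE_residual_le tikhonov_iterate_in_SINE_space CGNE_in_space)
  also have "\<dots> \<le> norm (b - T (CGNE s T b (Suc n)))"
    by (rule tikhonov_iterate_residual_le)
  finally show ?thesis unfolding Suc .
qed

end

section \<open>Comparison of the stopping indices\<close>

theorem theorem5p1:
  fixes scaleX :: "'k::real_or_complex \<Rightarrow> 'a::{real_inner, complete_space} \<Rightarrow> 'a"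
    and scaleY :: "'k \<Rightarrow> 'b::{real_inner, complete_space} \<Rightarrow> 'b"
    and T :: "'a \<Rightarrow> 'b"
    and y y\<delta> :: 'b
    and \<delta> \<tau> \<gamma> :: real
  assumes "hilbert_space_over scaleX" and "hilbert_space_over scaleY"
    and "Vector_Spaces.linear scaleX scaleY T" and "continuous_on UNIV T"
    and "\<not> closed (range T)"
    and "y \<in> range T"
    and "\<delta> > 0" and "norm (y\<delta> - y) \<le> \<delta>"
    and "\<tau> > 1" and "\<gamma> > 0"
  shows "0 \<le> stopping_index T \<tau> \<delta> y\<delta> (SINE scaleX T \<gamma> y\<delta>)
    \<and> stopping_index T \<tau> \<delta> y\<delta> (SINE scaleX T \<gamma> y\<delta>)
        \<le> stopping_index T \<tau> \<delta> y\<delta> (CGNE scaleX T y\<delta>)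
    \<and> stopping_index T \<tau> \<delta> y\<delta> (CGNE scaleX T y\<delta>) < \<infinity>"
proof (intro conjI)
  interpret regularised_operator scaleX scaleY T \<gamma>
    using assms by (intro regularised_operator.intro hilbert_operator.intro regularised_operator_axioms.intro)
  \<comment> \<open>Every index accepted for CGNE is accepted for SINE, and the infimum over a
    larger set is smaller.\<close>
  show "stopping_index T \<tau> \<delta> y\<delta> (SINE scaleX T \<gamma> y\<delta>)
      \<le> stopping_index T \<tau> \<delta> y\<delta> (CGNE scaleX T y\<delta>)"
    unfolding stopping_index_def
    by (intro Inf_superset_mono image_mono)
      (auto intro: order_trans [OF SINE_residual_le_CGNE_residual])
  obtain x where x: "norm (y\<delta> - T x) \<le> \<delta>" using assms(6,8) by blast
  \<comment> \<open>The slack left by \<open>\<tau> > 1\<close>: adding it to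
    \<open>\<delta>\<close> gives exactly the threshold \<open>\<tau> * \<delta>\<close>.\<close>
  have "0 < (\<tau> - 1) * \<delta>" using assms(7,9) by simp
  then obtain m where "norm (y\<delta> - T (CGNE scaleX T y\<delta> m)) \<le> \<delta> + (\<tau> - 1) * \<delta>"
    by (rule CGNE_residual_eventually_small [OF x])
  then have "stopping_index T \<tau> \<delta> y\<delta> (CGNE scaleX T y\<delta>) \<le> enat m"
    unfolding stopping_index_def by (intro Inf_lower) (simp add: algebra_simps)
  also have "enat m < \<infinity>" by simp
  finally show "stopping_index T \<tau> \<delta> y\<delta> (CGNE scaleX T y\<delta>) < \<infinity>" .
qed simp

end
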